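(* Let $G$ be a finite graph having $P_{3,2}$ as a full subgraph; that is, $G$ has six distinct vertices $u_1,u_2,u_3,v_1,v_2,v_3$ such that the full subgraph of $G$ on them has exactly the edges $u_1u_2$, $u_2u_3$, $v_1v_2$, $v_2v_3$, $u_1v_1$, $u_2v_2$, $u_3v_3$. Let $H$ be the graph obtained from $G$ by replacing this $P_{3,2}$ with $P_{3,6}$ as follows: remove the edges $u_1v_1$, $u_2v_2$, $u_3v_3$, add twelve new vertices $p_{i,j}$ ($1\le i\le 3$, $2\le j\le 5$), and add the edges $$u_ip_{i,2},\quad p_{i,2}p_{i,3},\quad p_{i,3}p_{i,4},\quad p_{i,4}p_{i,5},\quad p_{i,5}v_{4-i}\qquad (i=1,2,3)$$ and $$p_{1,j}p_{2,j},\quad p_{2,j}p_{3,j}\qquad (j=2,3,4,5)$$ (all other vertices and edges of $G$, including $u_1u_2,u_2u_3,v_1v_2,v_2v_3$, are unchanged). Then $I(H)$ and $\Sigma^3 I(G)$ have the same simple homotopy type.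
   Context: Graphs are finite and undirected; loops and multiple edges are allowed. A full subgraph is an induced subgraph. The planar square grid graph $P_{m,n}$ has vertex set $\{1,\dots,m\}\times\{1,\dots,n\}$, with $(i_1,j_1)$ and $(i_2,j_2)$ adjacent if and only if they differ by exactly $1$ in one coordinate and agree in the other. In $H$, the full subgraph on the $u_i$, $p_{i,j}$, $v_i$ is a copy of $P_{3,6}$ whose $i$-th row is $u_i,p_{i,2},p_{i,3},p_{i,4},p_{i,5},v_{4-i}$. An independent set of a graph is a set of vertices no two of which are joined by an edge (a vertex carrying a loop belongs to no independent set). The independence complex $I(G)$ is the simplicial complex whose simplices are the independent sets of $G$ (including the empty set $\emptyset$). For a simplicial complex $K$, $\Sigma K$ denotes the simplicial suspension of $K$, i.e. the join of $K$ with $\partial\Delta^1$ (two points), and $\Sigma^3$ is its threefold iterate. An elementary collapse of a simplicial complex removes a pair of simplices $\sigma\subsetneq\tau$, with $\sigma$ nonempty, $\dim\tau=\dim\sigma+1$, and $\tau$ the only simplex properly containing $\sigma$; an elementary expansion is the inverse operation. Two finite simplicial complexes have the same simple homotopy type if they are connected, up to simplicial isomorphism, by a finite sequence of elementary collapses and elementary expansions. *)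

theory Defs
  imports Main "HOL-Library.Multiset" "HOL-Library.Uprod"
begin

section \<open>Finite undirected multigraphs\<close>

text \<open>An edge is the unordered pair of its end points, so \<^term>\<open>Upair x x\<close> is a loop at \<open>x\<close>, and
  multiple edges are recorded by their multiplicity in the multiset of edges.\<close>

record 'v multigraph =
  graph_verts :: "'v set"
  graph_edges :: "'v uprod multiset"

definition finite_graph :: "'v multigraph \<Rightarrow> bool" where
  "finite_graph G \<longleftrightarrow>
     finite (graph_verts G) \<and> (\<forall>e \<in># graph_edges G. set_uprod e \<subseteq> graph_verts G)"

definition full_subgraph :: "'v multigraph \<Rightarrow> 'v set \<Rightarrow> 'v multigraph" where
  "full_subgraph G S =
     \<lparr>graph_verts = graph_verts G \<inter> S,
      graph_edges = {#e \<in># graph_edges G. set_uprod e \<subseteq> S#}\<rparr>"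

text \<open>The case \<open>x = y\<close> is included on purpose: a looped vertex lies in no independent set.\<close>

definition independent_set :: "'v multigraph \<Rightarrow> 'v set \<Rightarrow> bool" where
  "independent_set G S \<longleftrightarrow>
     S \<subseteq> graph_verts G \<and> (\<forall>x\<in>S. \<forall>y\<in>S. Upair x y \<notin># graph_edges G)"


section \<open>Abstract simplicial complexes\<close>

text \<open>Complexes contain the empty simplex. The vertices of \<open>K\<close> are the elements of \<open>\<Union>K\<close>, that is,
  those \<open>x\<close> for which \<open>{x}\<close> is a simplex.\<close>

definition finite_abstract_complex :: "'a set set \<Rightarrow> bool" where
  "finite_abstract_complex K \<longleftrightarrow>
     finite K \<and> (\<forall>\<sigma>\<in>K. finite \<sigma>) \<and> {} \<in> K \<and> (\<forall>\<sigma>\<in>K. \<forall>\<rho>. \<rho> \<subseteq> \<sigma> \<longrightarrow> \<rho> \<in> K)"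

definition independence_complex :: "'v multigraph \<Rightarrow> 'v set set" where
  "independence_complex G = {S. independent_set G S}"

definition complex_join :: "'a set set \<Rightarrow> 'b set set \<Rightarrow> ('a + 'b) set set" where
  "complex_join K L = {\<sigma> <+> \<tau> | \<sigma> \<tau>. \<sigma> \<in> K \<and> \<tau> \<in> L}"

text \<open>The boundary of the 1-simplex whose two vertices are the two elements of \<^typ>\<open>bool\<close>.\<close>

definition boundary_1_simplex :: "bool set set" where
  "boundary_1_simplex = {\<sigma>. \<sigma> \<subset> UNIV}"

definition simplicial_suspension :: "'a set set \<Rightarrow> ('a + bool) set set" where
  "simplicial_suspension K = complex_join K boundary_1_simplex"

definition simplicially_isomorphic :: "'a set set \<Rightarrow> 'b set set \<Rightarrow> bool" where
  "simplicially_isomorphic K L \<longleftrightarrow> (\<exists>f. inj_on f (\<Union>K) \<and> L = (\<lambda>\<sigma>. f ` \<sigma>) ` K)"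


section \<open>Simple homotopy type\<close>

definition elementary_collapse :: "'a set set \<Rightarrow> 'a set set \<Rightarrow> bool" where
  "elementary_collapse K L \<longleftrightarrow>
     finite_abstract_complex K \<and>
     (\<exists>\<sigma>\<in>K. \<exists>\<tau>\<in>K. \<sigma> \<noteq> {} \<and> \<sigma> \<subset> \<tau> \<and> card \<tau> = card \<sigma> + 1 \<and>
        (\<forall>\<rho>\<in>K. \<sigma> \<subset> \<rho> \<longrightarrow> \<rho> = \<tau>) \<and> L = K - {\<sigma>, \<tau>})"

definition simple_homotopy_step :: "'a set set \<Rightarrow> 'a set set \<Rightarrow> bool" where
  "simple_homotopy_step K L \<longleftrightarrow>
     elementary_collapse K L \<or> elementary_collapse L K \<or> simplicially_isomorphic K L"

text \<open>An expansion may need vertices outside the given vertex type, and the two complexes may have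
  different vertex types. The sequence of moves therefore takes place among complexes on natural
  numbers; every finite complex is isomorphic to one of these, and fresh vertices never run out.\<close>

definition same_simple_homotopy_type :: "'a set set \<Rightarrow> 'b set set \<Rightarrow> bool" where
  "same_simple_homotopy_type K L \<longleftrightarrow>
     finite_abstract_complex K \<and> finite_abstract_complex L \<and>
     (\<exists>(K' :: nat set set) (L' :: nat set set).
        simplicially_isomorphic K K' \<and> simplicially_isomorphic L L' \<and>
        simple_homotopy_step\<^sup>*\<^sup>* K' L')"


section \<open>Replacing a \<open>3 \<times> 2\<close> grid by a \<open>3 \<times> 6\<close> grid\<close>

text \<open>A vertex \<open>x\<close> of \<open>G\<close> becomes \<^term>\<open>Inl x\<close>, and the new vertex \<open>p\<close> with indices \<open>i, j\<close> is
  \<^term>\<open>Inr (i, j)\<close>. The functions \<open>u\<close> and \<open>v\<close> matter only on \<open>{1..3}\<close>.\<close>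

definition replace_grid ::
  "'v multigraph \<Rightarrow> (nat \<Rightarrow> 'v) \<Rightarrow> (nat \<Rightarrow> 'v) \<Rightarrow> ('v + nat \<times> nat) multigraph" where
  "replace_grid G u v =
     (let p = (\<lambda>i j. Inr (i, j)) in
      \<lparr>graph_verts = Inl ` graph_verts G \<union> (\<Union>i\<in>{1..3}. \<Union>j\<in>{2..5}. {p i j}),
       graph_edges =
         image_mset (map_uprod Inl)
           (graph_edges G - {#Upair (u 1) (v 1), Upair (u 2) (v 2), Upair (u 3) (v 3)#})
         + (\<Sum>i\<in>{1..3}. {#Upair (Inl (u i)) (p i 2), Upair (p i 2) (p i 3), Upair (p i 3) (p i 4),
                         Upair (p i 4) (p i 5), Upair (p i 5) (Inl (v (4 - i)))#})
         + (\<Sum>j\<in>{2..5}. {#Upair (p 1 j) (p 2 j), Upair (p 2 j) (p 3 j)#})\<rparr>)"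

end

theory Submission
  imports Defs
begin

text \<open>Removing the open star of a simplex \<open>s\<close> from an independence complex is a sequence of collapses
  as soon as the link of \<open>s\<close>, which is again an independence complex, can be reduced to a cone by
  folds: if the neighbourhood of \<open>a\<close> is contained in that of \<open>b\<close>, then \<open>b\<close> may be discarded. Applied to
  one or two vertices of the grid, this allows deleting a vertex or toggling an edge of the graph
  without changing the simple homotopy type. Every fold used has \<open>a\<close> among the twelve new vertices,
  so it is valid whatever \<open>G\<close> looks like outside the grid. Thirteen such moves turn \<open>H\<close> into the
  disjoint union of \<open>G\<close> and three edges, and each of these edges contributes one suspension.\<close>

section \<open>Collapsing open stars\<close>

lemma elementary_collapse_subset: "elementary_collapse K L \<Longrightarrow> L \<subseteq> K"
  by (auto simp: elementary_collapse_def)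

text \<open>The link of \<open>s\<close> is a cone with apex \<open>a\<close>, so the simplices
  containing \<open>s\<close> pair off as \<open>\<sigma>\<close> and
  \<open>insert a \<sigma>\<close>. Removing maximal pairs first makes each removal an elementary
  collapse; the induction is on the number of simplices.\<close>

lemma collapse_cone_star:
  assumes "finite_abstract_complex K" "s \<noteq> {}" "a \<notin> s"
    and "\<And>\<sigma>. \<lbrakk>\<sigma> \<in> K; s \<subseteq> \<sigma>\<rbrakk> \<Longrightarrow> insert a \<sigma> \<in> K"
  shows "elementary_collapse\<^sup>*\<^sup>* K {\<sigma> \<in> K. \<not> s \<subseteq> \<sigma>}"
  using assms
proof (induction "card K" arbitrary: K rule: less_induct)
  case less
  have fin: "finite K" and finm: "\<And>\<sigma>. \<sigma> \<in> K \<Longrightarrow> finite \<sigma>" and empty: "{} \<in> K"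
    and down: "\<And>\<sigma> \<rho>. \<sigma> \<in> K \<Longrightarrow> \<rho> \<subseteq> \<sigma> \<Longrightarrow> \<rho> \<in> K"
    using less.prems(1) by (auto simp: finite_abstract_complex_def)
  let ?M = "{\<sigma> \<in> K. s \<subseteq> \<sigma> \<and> a \<notin> \<sigma>}"
  show ?case
  proof (cases "\<exists>\<rho>\<in>K. s \<subseteq> \<rho>")
    case False
    then have "{\<sigma> \<in> K. \<not> s \<subseteq> \<sigma>} = K" by auto
    then show ?thesis by simp
  next
    case True
    then obtain \<rho> where "\<rho> \<in> K" "s \<subseteq> \<rho>" by auto
    then have "\<rho> - {a} \<in> ?M" using down[of \<rho> "\<rho> - {a}"] less.prems(3) by auto
    then have "?M \<noteq> {}" by blast
    moreover have "finite ?M" using fin by simp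
    ultimately obtain \<sigma> where \<sigma>: "\<sigma> \<in> ?M" and max': "\<forall>\<rho>\<in>?M. \<sigma> \<subseteq> \<rho> \<longrightarrow> \<sigma> = \<rho>"
      using finite_has_maximal[of ?M] by blast
    have max: "\<rho> = \<sigma>" if "\<rho> \<in> ?M" "\<sigma> \<subseteq> \<rho>" for \<rho>
      using max' that by blast
    let ?\<tau> = "insert a \<sigma>"
    let ?L = "K - {\<sigma>, ?\<tau>}"
    have \<tau>: "?\<tau> \<in> K" using \<sigma> less.prems(4) by auto
    \<comment> \<open>A larger \<open>\<rho>\<close> still contains \<open>s\<close> after dropping
      \<open>a\<close>, so maximality of \<open>\<sigma>\<close> forces
      \<open>\<rho> - {a} = \<sigma>\<close>, and \<open>\<rho>\<close> can only exceed
      \<open>\<sigma>\<close> by \<open>a\<close>.\<close>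
    have free: "\<rho> = ?\<tau>" if "\<rho> \<in> K" "\<sigma> \<subset> \<rho>" for \<rho>
    proof -
      have "\<rho> - {a} \<in> ?M" using that \<sigma> down[of \<rho> "\<rho> - {a}"] by auto
      then have "\<rho> - {a} = \<sigma>" using max[of "\<rho> - {a}"] that \<sigma> by auto
      then show ?thesis using that by auto
    qed
    have "\<sigma> \<noteq> {}" using \<sigma> less.prems(2) by auto
    moreover have "\<sigma> \<subset> ?\<tau>" "card ?\<tau> = card \<sigma> + 1" using \<sigma> finm by auto
    ultimately have step: "elementary_collapse K ?L"
      unfolding elementary_collapse_def using less.prems(1) \<sigma> \<tau> free by blast
    have downL: "\<rho> \<in> ?L" if "\<rho>' \<in> ?L" "\<rho> \<subseteq> \<rho>'" for \<rho> \<rho>'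
    proof -
      have "\<rho> \<in> K" using that down by blast
      moreover have "\<rho> \<noteq> \<sigma>" using that free[of \<rho>'] by auto
      moreover have "\<rho> \<noteq> ?\<tau>" 
        using that free[of \<rho>'] \<sigma> by auto
      ultimately show ?thesis by simp
    qed
    have "finite_abstract_complex ?L"
      unfolding finite_abstract_complex_def
    proof (intro conjI ballI allI impI)
      show "\<rho> \<in> ?L" if "\<rho>' \<in> ?L" "\<rho> \<subseteq> \<rho>'" for \<rho> \<rho>' using downL that .
    qed (use fin finm empty \<open>\<sigma> \<noteq> {}\<close> in auto)
    moreover have "card ?L < card K" using fin \<sigma> by (auto intro: psubset_card_mono)
    \<comment> \<open>The cone condition survives: \<open>insert a \<rho>\<close> equals
      \<open>insert a \<sigma>\<close> only if \<open>\<rho>\<close> is one of the two removed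
      simplices.\<close>
    moreover have "insert a \<rho> \<in> ?L" if "\<rho> \<in> ?L" "s \<subseteq> \<rho>" for \<rho>
    proof -
      have "insert a \<rho> \<in> K" using that less.prems(4) by auto
      moreover have "insert a \<rho> \<noteq> \<sigma>" using \<sigma> by auto
      moreover have "insert a \<rho> \<noteq> ?\<tau>"
        using that \<sigma> by (cases "a \<in> \<rho>") (auto simp: insert_absorb insert_ident)
      ultimately show ?thesis by simp
    qed
    ultimately have "elementary_collapse\<^sup>*\<^sup>* ?L {\<rho> \<in> ?L. \<not> s \<subseteq> \<rho>}"
      using less.hyps[of ?L] less.prems by blast
    moreover have "{\<rho> \<in> ?L. \<not> s \<subseteq> \<rho>} = {\<rho> \<in> K. \<not> s \<subseteq> \<rho>}" using \<sigma> by auto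
    ultimately show ?thesis using step by (simp add: converse_rtranclp_into_rtranclp)
  qed
qed

section \<open>Independence complexes of relations\<close>

definition indep :: "'a set \<Rightarrow> ('a \<Rightarrow> 'a \<Rightarrow> bool) \<Rightarrow> 'a set set" where
  "indep V E = {S. S \<subseteq> V \<and> (\<forall>x\<in>S. \<forall>y\<in>S. \<not> E x y)}"

lemma Union_indep: "\<Union>(indep V E) \<subseteq> V"
  by (auto simp: indep_def)

lemma finite_complex_indep: "finite V \<Longrightarrow> finite_abstract_complex (indep V E)"
  by (auto simp: finite_abstract_complex_def indep_def intro: finite_subset)

section \<open>Thinning the link of a simplex by folds\<close>

text \<open>The intermediate stages of the removal of the open star of \<open>s\<close>: the vertices in \<open>D\<close> have been
  discarded from the link of \<open>s\<close>.\<close>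

definition thin_star :: "'a set set \<Rightarrow> 'a set \<Rightarrow> 'a set \<Rightarrow> 'a set set" where
  "thin_star K s D = {\<sigma> \<in> K. s \<subseteq> \<sigma> \<longrightarrow> \<sigma> \<inter> D = {}}"

lemma finite_complex_thin_star:
  "finite_abstract_complex K \<Longrightarrow> s \<noteq> {} \<Longrightarrow> finite_abstract_complex (thin_star K s D)"
  unfolding finite_abstract_complex_def thin_star_def by auto

text \<open>Every neighbour of \<open>a\<close> lies in \<open>D\<close>, which
  \<open>\<sigma>\<close> avoids, or is adjacent to a vertex of \<open>s'\<close>, which
  \<open>\<sigma>\<close> contains; so \<open>\<sigma>\<close> has no neighbour of \<open>a\<close>.
  The choice \<open>s' = insert b s\<close> serves the folds, and \<open>s' = s\<close> the final
  cone.\<close>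

lemma insert_thin_star_indep:
  assumes "a \<in> V" "\<not> E a a" "a \<notin> D" "symp E"
    and nbr: "\<And>y. E a y \<Longrightarrow> y \<in> D \<or> (\<exists>x\<in>s'. E x y)"
    and "s \<subseteq> s'" "\<sigma> \<in> thin_star (indep V E) s D" "s' \<subseteq> \<sigma>"
  shows "insert a \<sigma> \<in> thin_star (indep V E) s D"
proof -
  have \<sigma>: "\<sigma> \<subseteq> V" "\<And>x y. x \<in> \<sigma> \<Longrightarrow> y \<in> \<sigma> \<Longrightarrow> \<not> E x y" "\<sigma> \<inter> D = {}"
    using assms(6-8) by (auto simp: thin_star_def indep_def)
  have "\<not> E a y" "\<not> E y a" if "y \<in> \<sigma>" for y
    using nbr[of y] \<sigma>(2)[OF _ that] \<sigma>(3) that assms(8) sympD[OF \<open>symp E\<close>, of y a] by blast+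
  then show ?thesis using \<sigma> assms(1-3) by (auto simp: thin_star_def indep_def)
qed

text \<open>Discarding \<open>b\<close> from the link of \<open>s\<close> amounts to removing the
  open star of \<open>insert b s\<close>. The domination hypothesis makes the thinned link of that
  larger set a cone with apex \<open>a\<close>.\<close>

lemma thin_star_fold:
  assumes "finite V" "symp E" "s \<noteq> {}" "a \<in> V" "\<not> E a a" "a \<notin> D" "a \<notin> insert b s"
    and nbr: "\<And>y. E a y \<Longrightarrow> y \<in> D \<or> (\<exists>x\<in>insert b s. E x y)"
  shows "elementary_collapse\<^sup>*\<^sup>* (thin_star (indep V E) s D) (thin_star (indep V E) s (insert b D))"
proof -
  let ?K = "thin_star (indep V E) s D"
  have "elementary_collapse\<^sup>*\<^sup>* ?K {\<sigma> \<in> ?K. \<not> insert b s \<subseteq> \<sigma>}"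
  proof (rule collapse_cone_star[where a = a])
    show "insert a \<sigma> \<in> ?K" if "\<sigma> \<in> ?K" "insert b s \<subseteq> \<sigma>" for \<sigma>
      by (rule insert_thin_star_indep[where s' = "insert b s"]) (use assms that in auto)
  qed (use assms in \<open>simp_all add: finite_complex_thin_star finite_complex_indep\<close>)
  also have "{\<sigma> \<in> ?K. \<not> insert b s \<subseteq> \<sigma>} = thin_star (indep V E) s (insert b D)"
    by (auto simp: thin_star_def)
  finally show ?thesis .
qed

text \<open>In what remains of the link of \<open>s\<close>, the vertex \<open>a\<close> has no
  neighbour left, so this link is a cone and the whole open star can go.\<close>

lemma thin_star_isolated:
  assumes "finite V" "symp E" "s \<noteq> {}" "a \<in> V" "\<not> E a a" "a \<notin> D" "a \<notin> s"
    and nbr: "\<And>y. E a y \<Longrightarrow> y \<in> D \<or> (\<exists>x\<in>s. E x y)"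
  shows "elementary_collapse\<^sup>*\<^sup>* (thin_star (indep V E) s D) {\<sigma> \<in> indep V E. \<not> s \<subseteq> \<sigma>}"
proof -
  let ?K = "thin_star (indep V E) s D"
  have "elementary_collapse\<^sup>*\<^sup>* ?K {\<sigma> \<in> ?K. \<not> s \<subseteq> \<sigma>}"
  proof (rule collapse_cone_star[where a = a])
    show "insert a \<sigma> \<in> ?K" if "\<sigma> \<in> ?K" "s \<subseteq> \<sigma>" for \<sigma>
      by (rule insert_thin_star_indep[where s' = s]) (use assms that in auto)
  qed (use assms in \<open>simp_all add: finite_complex_thin_star finite_complex_indep\<close>)
  also have "{\<sigma> \<in> ?K. \<not> s \<subseteq> \<sigma>} = {\<sigma> \<in> indep V E. \<not> s \<subseteq> \<sigma>}"
    by (auto simp: thin_star_def)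
  finally show ?thesis .
qed

section \<open>Checking sequences of moves\<close>

text \<open>A point \<open>(i, j)\<close> stands for the vertex in row \<open>i\<close> and column \<open>j\<close> of the \<open>3 \<times> 6\<close> grid; columns 1
  and 6 belong to \<open>G\<close>.\<close>

type_synonym point = "nat \<times> nat"

definition adj :: "(point \<times> point) list \<Rightarrow> point \<Rightarrow> point \<Rightarrow> bool" where
  "adj F x y \<longleftrightarrow> (x, y) \<in> set F \<or> (y, x) \<in> set F"

definition nbrs :: "(point \<times> point) list \<Rightarrow> point \<Rightarrow> point list" where
  "nbrs F a = map snd (filter (\<lambda>e. fst e = a) F) @ map fst (filter (\<lambda>e. snd e = a) F)"

lemma set_nbrs: "set (nbrs F a) = {y. adj F a y}"
  by (force simp: nbrs_def adj_def)

definition interior_point :: "point \<Rightarrow> bool" where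
  "interior_point a \<longleftrightarrow> snd a \<noteq> 1 \<and> snd a \<noteq> 6"

text \<open>The point \<open>a\<close> must be interior because only then does the edge list show
  its whole neighbourhood; a vertex of \<open>G\<close> may have further neighbours. The condition
  \<open>y \<noteq> a\<close> excludes a loop.\<close>

definition apex :: "point list \<Rightarrow> (point \<times> point) list \<Rightarrow> point list \<Rightarrow> point list \<Rightarrow> point \<Rightarrow> bool" where
  "apex A F s D a \<longleftrightarrow> interior_point a \<and> a \<in> set A \<and> a \<notin> set s \<and> a \<notin> set D \<and>
     (\<forall>y\<in>set (nbrs F a). y \<noteq> a \<and> (y \<in> set D \<or> (\<exists>x\<in>set s. adj F x y)))"

primrec folds :: "point list \<Rightarrow> (point \<times> point) list \<Rightarrow> point list \<Rightarrow> point list \<Rightarrow>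
    (point \<times> point) list \<Rightarrow> point \<Rightarrow> bool" where
  "folds A F s D [] c \<longleftrightarrow> apex A F s D c"
| "folds A F s D (p # ps) c \<longleftrightarrow>
     apex A F (snd p # s) D (fst p) \<and> folds A F s (snd p # D) ps c"

text \<open>The last two arguments of a move certify that the link is contractible: a pair \<open>(a, b)\<close> discards
  \<open>b\<close> because \<open>a\<close> is dominated by it, and the final point is the apex of the remaining cone.\<close>

datatype move =
  Delete point "(point \<times> point) list" point
| Add point point "(point \<times> point) list" point
| Remove point point "(point \<times> point) list" point

text \<open>Adding an edge removes the open star of its two ends. Removing an edge is the same step
  read backwards, so its certificate is checked in the graph without the edge. A deleted vertex is
  interior, so that \<open>F\<close> lists all of its edges.\<close>

fun moves :: "move list \<Rightarrow> point list \<Rightarrow> (point \<times> point) list \<Rightarrow>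
    point list \<times> (point \<times> point) list \<Rightarrow> bool" where
  "moves [] A F r \<longleftrightarrow> r = (A, F)"
| "moves (Delete x ps c # ms) A F r \<longleftrightarrow> interior_point x \<and> folds A F [x] [] ps c \<and>
     moves ms (removeAll x A) (filter (\<lambda>e. fst e \<noteq> x \<and> snd e \<noteq> x) F) r"
| "moves (Add x y ps c # ms) A F r \<longleftrightarrow> folds A F [x, y] [] ps c \<and> moves ms A ((x, y) # F) r"
| "moves (Remove x y ps c # ms) A F r \<longleftrightarrow> adj F x y \<and>
     (let F' = filter (\<lambda>e. e \<noteq> (x, y) \<and> e \<noteq> (y, x)) F
      in folds A F' [x, y] [] ps c \<and> moves ms A F' r)"

text \<open>Found by a computer search.\<close>

definition grid_moves :: "move list" where
  "grid_moves =
    [Add (3, 1) (1, 6) [((2, 2), (1, 3)), ((3, 3), (2, 4))] (1, 4),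
     Remove (1, 6) (1, 5) [((1, 3), (2, 2)), ((2, 4), (3, 3))] (3, 2),
     Delete (3, 2) [((2, 3), (1, 4)), ((3, 4), (2, 5))] (1, 5),
     Delete (2, 4) [] (1, 5),
     Add (2, 1) (2, 6) [((1, 5), (1, 3))] (1, 2),
     Remove (2, 6) (2, 5) [((2, 2), (1, 3))] (1, 4),
     Delete (2, 2) [((1, 3), (1, 5)), ((2, 5), (3, 4))] (3, 3),
     Add (1, 1) (3, 6) [((2, 5), (1, 4)), ((3, 4), (2, 3))] (1, 3),
     Remove (3, 6) (3, 5) [((1, 5), (1, 3))] (1, 2),
     Delete (1, 2) [((1, 4), (2, 5)), ((3, 5), (3, 3))] (2, 3),
     Remove (1, 4) (1, 5) [((3, 5), (3, 3))] (2, 3),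
     Delete (2, 3) [] (1, 4),
     Delete (3, 5) [] (1, 5)]"

definition grid_points :: "point list" where
  "grid_points = [(1,2),(1,3),(1,4),(1,5),(2,2),(2,3),(2,4),(2,5),(3,2),(3,3),(3,4),(3,5)]"

definition grid_edges :: "(point \<times> point) list" where
  "grid_edges =
    [((1,1),(1,2)), ((1,2),(1,3)), ((1,3),(1,4)), ((1,4),(1,5)), ((1,5),(1,6)),
     ((2,1),(2,2)), ((2,2),(2,3)), ((2,3),(2,4)), ((2,4),(2,5)), ((2,5),(2,6)),
     ((3,1),(3,2)), ((3,2),(3,3)), ((3,3),(3,4)), ((3,4),(3,5)), ((3,5),(3,6)),
     ((1,1),(2,1)), ((1,2),(2,2)), ((1,3),(2,3)), ((1,4),(2,4)), ((1,5),(2,5)), ((1,6),(2,6)),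
     ((2,1),(3,1)), ((2,2),(3,2)), ((2,3),(3,3)), ((2,4),(3,4)), ((2,5),(3,5)), ((2,6),(3,6))]"

section \<open>Gluing a grid pattern to the rest of the graph\<close>

definition place :: "(nat \<Rightarrow> 'v) \<Rightarrow> (nat \<Rightarrow> 'v) \<Rightarrow> point \<Rightarrow> 'v + point" where
  "place u v p =
     (if snd p = 1 then Inl (u (fst p)) else if snd p = 6 then Inl (v (4 - fst p)) else Inr p)"

lemma place_interior: "interior_point p \<Longrightarrow> place u v p = Inr p"
  by (simp add: place_def interior_point_def)

lemma place_eq_Inr: "place u v p = Inr q \<longleftrightarrow> p = q \<and> interior_point q"
  by (auto simp: place_def interior_point_def)

definition glue_verts :: "'v set \<Rightarrow> point list \<Rightarrow> ('v + point) set" where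
  "glue_verts V A = Inl ` V \<union> Inr ` set A"

text \<open>\<open>B\<close> is the adjacency kept from \<open>G\<close>. The list \<open>F\<close>
  may also join two vertices of \<open>G\<close>, which is how the moves restore the edges between
  the \<open>u i\<close> and the \<open>v i\<close>.\<close>

definition glue_adj :: "('v \<Rightarrow> 'v \<Rightarrow> bool) \<Rightarrow> (nat \<Rightarrow> 'v) \<Rightarrow> (nat \<Rightarrow> 'v) \<Rightarrow> (point \<times> point) list \<Rightarrow>
    'v + point \<Rightarrow> 'v + point \<Rightarrow> bool" where
  "glue_adj B u v F x y \<longleftrightarrow>
     (\<exists>p q. x = Inl p \<and> y = Inl q \<and> B p q) \<or>
     (\<exists>p q. adj F p q \<and> x = place u v p \<and> y = place u v q)"

lemma symp_glue_adj: "symp B \<Longrightarrow> symp (glue_adj B u v F)"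
  unfolding symp_def glue_adj_def adj_def by blast

text \<open>No point other than \<open>a\<close> is placed at \<open>Inr a\<close>, so the edges
  there come from \<open>F\<close> alone.\<close>

lemma glue_adj_interior:
  "interior_point a \<Longrightarrow> glue_adj B u v F (Inr a) y \<longleftrightarrow> (\<exists>q. adj F a q \<and> y = place u v q)"
  by (auto simp: glue_adj_def place_eq_Inr eq_commute[of "Inr a"] simp del: split_paired_Ex)

abbreviation glue_complex where
  "glue_complex V B u v A F \<equiv> indep (glue_verts V A) (glue_adj B u v F)"

section \<open>Soundness of the fold certificates\<close>

lemma apex_sound:
  assumes "apex A F s D a"
  shows "Inr a \<in> glue_verts V A" "\<not> glue_adj B u v F (Inr a) (Inr a)"
    "Inr a \<notin> place u v ` set D" "Inr a \<notin> place u v ` set s"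
    "glue_adj B u v F (Inr a) y \<Longrightarrow>
       y \<in> place u v ` set D \<or> (\<exists>x\<in>place u v ` set s. glue_adj B u v F x y)"
proof -
  have a: "interior_point a" "a \<in> set A" "a \<notin> set s" "a \<notin> set D"
    and nbr: "\<And>y. adj F a y \<Longrightarrow> y \<noteq> a \<and> (y \<in> set D \<or> (\<exists>x\<in>set s. adj F x y))"
    using assms by (auto simp: apex_def set_nbrs)
  show "Inr a \<in> glue_verts V A" using a by (simp add: glue_verts_def)
  show "\<not> glue_adj B u v F (Inr a) (Inr a)"
    using nbr a(1) by (auto simp: glue_adj_interior place_eq_Inr eq_commute[of "Inr a"])
  show "Inr a \<notin> place u v ` set D" "Inr a \<notin> place u v ` set s"
    using a by (auto simp: place_eq_Inr eq_commute[of "Inr a"])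
  show "y \<in> place u v ` set D \<or> (\<exists>x\<in>place u v ` set s. glue_adj B u v F x y)"
    if adj: "glue_adj B u v F (Inr a) y"
  proof -
    obtain q where q: "adj F a q" "y = place u v q"
      using adj a(1) by (auto simp: glue_adj_interior)
    \<comment> \<open>Domination only asks for edges towards \<open>s\<close>, never for their
      absence, so further edges of \<open>G\<close> cannot spoil it.\<close>
    from nbr[OF q(1)] consider "q \<in> set D" | x where "x \<in> set s" "adj F x q" by blast
    then show ?thesis
    proof cases
      case 2
      then have "glue_adj B u v F (place u v x) y" unfolding glue_adj_def q(2) by blast
      then show ?thesis using 2 by blast
    qed (use q in auto)
  qed
qed

text \<open>Each pair moves one vertex into \<open>D\<close> by \<open>thin_star_fold\<close>; the
  last point then empties the open star by \<open>thin_star_isolated\<close>.\<close>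

lemma folds_sound:
  assumes "finite V" "symp B" "s \<noteq> []" "folds A F s D ps c"
  shows "elementary_collapse\<^sup>*\<^sup>*
    (thin_star (glue_complex V B u v A F) (place u v ` set s) (place u v ` set D))
    {\<sigma> \<in> glue_complex V B u v A F. \<not> place u v ` set s \<subseteq> \<sigma>}"
  using assms(4)
proof (induction ps arbitrary: D)
  case Nil
  then have "apex A F s D c" by simp
  note c = apex_sound[OF this]
  show ?case
    by (rule thin_star_isolated[where a = "Inr c"])
      (use assms c in \<open>simp_all add: glue_verts_def symp_glue_adj\<close>)
next
  case (Cons p ps)
  then have p: "apex A F (snd p # s) D (fst p)" and ps: "folds A F s (snd p # D) ps c" by auto
  note a = apex_sound[OF p]
  have "elementary_collapse\<^sup>*\<^sup>*
    (thin_star (glue_complex V B u v A F) (place u v ` set s) (place u v ` set D))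
    (thin_star (glue_complex V B u v A F) (place u v ` set s)
      (insert (place u v (snd p)) (place u v ` set D)))"
  proof (rule thin_star_fold[where a = "Inr (fst p)"])
    show "y \<in> place u v ` set D \<or>
        (\<exists>x\<in>insert (place u v (snd p)) (place u v ` set s). glue_adj B u v F x y)"
      if "glue_adj B u v F (Inr (fst p)) y" for y
      using a(5)[OF that] by simp
  qed (use assms a(1-4) in \<open>simp_all add: glue_verts_def symp_glue_adj\<close>)
  then show ?case using Cons.IH[OF ps] by simp
qed

lemma folds_sound_complex:
  assumes "finite V" "symp B" "s \<noteq> []" "folds A F s [] ps c"
  shows "elementary_collapse\<^sup>*\<^sup>* (glue_complex V B u v A F)
    {\<sigma> \<in> glue_complex V B u v A F. \<not> place u v ` set s \<subseteq> \<sigma>}"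
  using folds_sound[OF assms] by (simp add: thin_star_def)

section \<open>Transport to complexes on the natural numbers\<close>

lemma finite_complex_image:
  assumes "finite_abstract_complex K"
  shows "finite_abstract_complex ((`) f ` K)"
proof -
  have "\<rho> \<in> (`) f ` K" if "\<sigma> \<in> K" "\<rho> \<subseteq> f ` \<sigma>" for \<sigma> \<rho>
  proof -
    obtain \<rho>' where "\<rho>' \<subseteq> \<sigma>" "\<rho> = f ` \<rho>'" using \<open>\<rho> \<subseteq> f ` \<sigma>\<close> by (meson subset_imageE)
    moreover have "\<rho>' \<in> K" using calculation that assms by (auto simp: finite_abstract_complex_def)
    ultimately show ?thesis by blast
  qed
  then show ?thesis using assms by (auto simp: finite_abstract_complex_def)
qed

lemma elementary_collapse_image:
  assumes "elementary_collapse K L" "inj_on f (\<Union>K)"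
  shows "elementary_collapse ((`) f ` K) ((`) f ` L)"
proof -
  obtain \<sigma> \<tau> where K: "finite_abstract_complex K" and st: "\<sigma> \<in> K" "\<tau> \<in> K" "\<sigma> \<noteq> {}" "\<sigma> \<subset> \<tau>"
    "card \<tau> = card \<sigma> + 1" and free: "\<forall>\<rho>\<in>K. \<sigma> \<subset> \<rho> \<longrightarrow> \<rho> = \<tau>" and L: "L = K - {\<sigma>, \<tau>}"
    using assms(1) unfolding elementary_collapse_def by (elim conjE bexE)
  have inj: "inj_on f (\<sigma> \<union> \<rho>)" if "\<sigma> \<in> K" "\<rho> \<in> K" for \<sigma> \<rho>
    using assms(2) that by (auto intro: inj_on_subset)
  have injK: "inj_on ((`) f) K"
  proof (rule inj_onI)
    fix \<rho> \<rho>' assume "\<rho> \<in> K" "\<rho>' \<in> K" "f ` \<rho> = f ` \<rho>'"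
    then show "\<rho> = \<rho>'" using inj[of \<rho> \<rho>'] by (simp add: inj_on_Un_image_eq_iff)
  qed
  \<comment> \<open>The direction from images back to simplices keeps the removed face free: a
    simplex properly containing its image comes from one in \<open>K\<close>.\<close>
  have sub: "f ` \<rho> \<subset> f ` \<rho>' \<longleftrightarrow> \<rho> \<subset> \<rho>'" if "\<rho> \<in> K" "\<rho>' \<in> K" for \<rho> \<rho>'
  proof -
    have "f ` \<rho> \<subseteq> f ` \<rho>' \<longleftrightarrow> \<rho> \<subseteq> \<rho>'"
    proof -
      have "f x \<in> f ` \<rho>' \<longleftrightarrow> x \<in> \<rho>'" if "x \<in> \<rho>" for x
        using inj_on_image_mem_iff[OF assms(2), of x \<rho>'] that \<open>\<rho> \<in> K\<close> \<open>\<rho>' \<in> K\<close> by blast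
      then show ?thesis by (auto simp: image_subset_iff)
    qed
    moreover have "f ` \<rho> = f ` \<rho>' \<longleftrightarrow> \<rho> = \<rho>'" using injK that by (auto dest: inj_onD)
    ultimately show ?thesis by (simp add: psubset_eq)
  qed
  have card: "card (f ` \<rho>) = card \<rho>" if "\<rho> \<in> K" for \<rho>
    using inj[OF that that] by (simp add: card_image)
  have L': "(`) f ` L = (`) f ` K - {f ` \<sigma>, f ` \<tau>}"
    using injK st(1,2) unfolding L by (simp add: inj_on_image_set_diff)
  have free': "\<forall>\<rho>\<in>(`) f ` K. f ` \<sigma> \<subset> \<rho> \<longrightarrow> \<rho> = f ` \<tau>"
    using free sub st(1) by auto
  have "f ` \<sigma> \<noteq> {}" "f ` \<sigma> \<subset> f ` \<tau>" "card (f ` \<tau>) = card (f ` \<sigma>) + 1"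
    using st sub[OF st(1,2)] card by simp_all
  note pair = this free' L'
  have "\<exists>\<sigma>'\<in>(`) f ` K. \<exists>\<tau>'\<in>(`) f ` K. \<sigma>' \<noteq> {} \<and> \<sigma>' \<subset> \<tau>' \<and> card \<tau>' = card \<sigma>' + 1 \<and>
      (\<forall>\<rho>\<in>(`) f ` K. \<sigma>' \<subset> \<rho> \<longrightarrow> \<rho> = \<tau>') \<and> (`) f ` L = (`) f ` K - {\<sigma>', \<tau>'}"
  proof (rule bexI[where x = "f ` \<sigma>"], rule bexI[where x = "f ` \<tau>"])
    show "f ` \<sigma> \<noteq> {} \<and> f ` \<sigma> \<subset> f ` \<tau> \<and> card (f ` \<tau>) = card (f ` \<sigma>) + 1 \<and>
      (\<forall>\<rho>\<in>(`) f ` K. f ` \<sigma> \<subset> \<rho> \<longrightarrow> \<rho> = f ` \<tau>) \<and> (`) f ` L = (`) f ` K - {f ` \<sigma>, f ` \<tau>}"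
      by (intro conjI pair)
    show "f ` \<tau> \<in> (`) f ` K" "f ` \<sigma> \<in> (`) f ` K" using st(1,2) by simp_all
  qed
  with finite_complex_image[OF K] show ?thesis
    unfolding elementary_collapse_def by (rule conjI)
qed

lemma collapses_image:
  assumes "elementary_collapse\<^sup>*\<^sup>* K L" "inj_on f (\<Union>K)"
  shows "elementary_collapse\<^sup>*\<^sup>* ((`) f ` K) ((`) f ` L)"
  using assms
proof (induction rule: converse_rtranclp_induct)
  case (step K K')
  then have "\<Union>K' \<subseteq> \<Union>K" using elementary_collapse_subset by blast
  then have "inj_on f (\<Union>K')" using step.prems by (rule inj_on_subset[rotated])
  then show ?case
    using step.IH elementary_collapse_image[OF step.hyps(1) step.prems]
    by (simp add: converse_rtranclp_into_rtranclp)
qed simp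

lemma simple_homotopy_of_collapses:
  assumes "elementary_collapse\<^sup>*\<^sup>* K L"
  shows "simple_homotopy_step\<^sup>*\<^sup>* K L" "simple_homotopy_step\<^sup>*\<^sup>* L K"
  using assms
proof (induction rule: rtranclp_induct)
  case (step M N)
  then have "simple_homotopy_step M N" "simple_homotopy_step N M"
    by (auto simp: simple_homotopy_step_def)
  {
    case 1
    then show ?case using step by (meson rtranclp.rtrancl_into_rtrancl \<open>simple_homotopy_step M N\<close>)
  next
    case 2
    then show ?case using step by (meson converse_rtranclp_into_rtranclp \<open>simple_homotopy_step N M\<close>)
  }
qed simp_all

section \<open>The effect of a move on the independence complex\<close>

lemma glue_complex_delete:
  assumes "interior_point x"
  shows "{\<sigma> \<in> glue_complex V B u v A F. \<not> place u v ` set [x] \<subseteq> \<sigma>} =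
    glue_complex V B u v (removeAll x A) (filter (\<lambda>e. fst e \<noteq> x \<and> snd e \<noteq> x) F)"
proof -
  have V: "glue_verts V (removeAll x A) = glue_verts V A - {Inr x}"
    by (auto simp: glue_verts_def)
  \<comment> \<open>Only \<open>x\<close> itself is placed at \<open>Inr x\<close>, so the filter
    drops exactly the edges at that vertex.\<close>
  have E: "glue_adj B u v (filter (\<lambda>e. fst e \<noteq> x \<and> snd e \<noteq> x) F) y z \<longleftrightarrow> glue_adj B u v F y z"
    if "y \<noteq> Inr x" "z \<noteq> Inr x" for y z
    using that place_interior[OF assms, of u v] unfolding glue_adj_def adj_def by (auto; metis)
  show ?thesis
  proof (rule set_eqI)
    fix \<sigma>
    show "\<sigma> \<in> {\<sigma> \<in> glue_complex V B u v A F. \<not> place u v ` set [x] \<subseteq> \<sigma>} \<longleftrightarrow>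
      \<sigma> \<in> glue_complex V B u v (removeAll x A) (filter (\<lambda>e. fst e \<noteq> x \<and> snd e \<noteq> x) F)"
    proof (cases "Inr x \<in> \<sigma>")
      case True
      then show ?thesis using place_interior[OF assms, of u v] by (auto simp: indep_def V)
    next
      case False
      then have "(\<forall>y\<in>\<sigma>. \<forall>z\<in>\<sigma>. \<not> glue_adj B u v (filter (\<lambda>e. fst e \<noteq> x \<and> snd e \<noteq> x) F) y z)
          \<longleftrightarrow> (\<forall>y\<in>\<sigma>. \<forall>z\<in>\<sigma>. \<not> glue_adj B u v F y z)"
        by (intro ball_cong refl arg_cong[where f = Not] E) (use False in auto)
      then show ?thesis using False place_interior[OF assms, of u v] by (auto simp: indep_def V)
    qed
  qed
qed

text \<open>The independent sets forbidden by the new edge are those containing both of its ends,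
  that is, the open star of the two. The ends may be vertices of \<open>G\<close>.\<close>

lemma glue_complex_add:
  assumes "\<And>p q. adj F' p q \<longleftrightarrow> adj F p q \<or> {p, q} = {x, y}"
  shows "{\<sigma> \<in> glue_complex V B u v A F. \<not> place u v ` set [x, y] \<subseteq> \<sigma>} = glue_complex V B u v A F'"
proof -
  have "glue_adj B u v F' a b \<longleftrightarrow> glue_adj B u v F a b \<or> {a, b} = {place u v x, place u v y}" for a b
    unfolding glue_adj_def assms doubleton_eq_iff by blast
  then show ?thesis by (auto simp: indep_def doubleton_eq_iff)
qed

text \<open>No move creates a vertex, so one numbering \<open>f\<close> of the initial vertices
  serves the whole sequence, and the expansions need no fresh labels.\<close>

lemma moves_sound:
  assumes "finite V" "symp B" "moves ms A F (A', F')" "inj_on f (glue_verts V A)"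
  shows "simple_homotopy_step\<^sup>*\<^sup>* ((`) f ` glue_complex V B u v A F) ((`) f ` glue_complex V B u v A' F')"
  using assms(3,4)
proof (induction ms arbitrary: A F)
  case Nil
  then show ?case by simp
next
  case (Cons m ms)
  let ?K = "glue_complex V B u v"
  have inj: "inj_on f (\<Union>(?K A F))" for F
    using Cons.prems(2) Union_indep by (rule inj_on_subset)
  note star = folds_sound_complex[OF assms(1,2), THEN collapses_image, OF _ _ inj]
  show ?case
  proof (cases m)
    case (Delete x ps c)
    let ?A = "removeAll x A" and ?F = "filter (\<lambda>e. fst e \<noteq> x \<and> snd e \<noteq> x) F"
    have x: "interior_point x" "folds A F [x] [] ps c" and ms: "moves ms ?A ?F (A', F')"
      using Cons.prems(1) Delete by auto
    have "inj_on f (glue_verts V ?A)"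
      using Cons.prems(2) by (rule inj_on_subset) (auto simp: glue_verts_def)
    note IH = Cons.IH[OF ms this]
    have "elementary_collapse\<^sup>*\<^sup>* ((`) f ` ?K A F) ((`) f ` ?K ?A ?F)"
      using star[OF _ x(2)] unfolding glue_complex_delete[OF x(1)] by simp
    then show ?thesis using IH simple_homotopy_of_collapses(1) by (meson rtranclp_trans)
  next
    case (Add x y ps c)
    then have xy: "folds A F [x, y] [] ps c" and ms: "moves ms A ((x, y) # F) (A', F')"
      using Cons.prems(1) by auto
    have adj: "adj ((x, y) # F) p q \<longleftrightarrow> adj F p q \<or> {p, q} = {x, y}" for p q
      by (auto simp: adj_def doubleton_eq_iff)
    have "elementary_collapse\<^sup>*\<^sup>* ((`) f ` ?K A F) ((`) f ` ?K A ((x, y) # F))"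
      using star[OF _ xy] unfolding glue_complex_add[OF adj] by simp
    then show ?thesis using Cons.IH[OF ms Cons.prems(2)] simple_homotopy_of_collapses(1)
      by (meson rtranclp_trans)
  next
    case (Remove x y ps c)
    let ?F = "filter (\<lambda>e. e \<noteq> (x, y) \<and> e \<noteq> (y, x)) F"
    have xy: "adj F x y" "folds A ?F [x, y] [] ps c" and ms: "moves ms A ?F (A', F')"
      using Cons.prems(1) Remove by (auto simp: Let_def)
    have adj: "adj F p q \<longleftrightarrow> adj ?F p q \<or> {p, q} = {x, y}" for p q
      using xy(1) by (auto simp: adj_def doubleton_eq_iff)
    \<comment> \<open>The graph without the edge has the larger complex, which collapses onto the
      current one; the move itself therefore consists of expansions.\<close>
    have "elementary_collapse\<^sup>*\<^sup>* ((`) f ` ?K A ?F) ((`) f ` ?K A F)"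
      using star[OF _ xy(2)] unfolding glue_complex_add[OF adj] by simp
    then show ?thesis using Cons.IH[OF ms Cons.prems(2)] simple_homotopy_of_collapses(2)
      by (meson rtranclp_trans)
  qed
qed

section \<open>Suspensions\<close>

lemma boundary_1_simplex_eq: "boundary_1_simplex = {{}, {True}, {False}}"
proof -
  have "\<sigma> \<subset> UNIV \<longleftrightarrow> \<sigma> \<in> {{}, {True}, {False}}" for \<sigma> :: "bool set"
    by (cases "True \<in> \<sigma>"; cases "False \<in> \<sigma>") (auto simp: UNIV_bool)
  then show ?thesis by (auto simp: boundary_1_simplex_def)
qed

lemma finite_complex_suspension:
  assumes "finite_abstract_complex K"
  shows "finite_abstract_complex (simplicial_suspension K)"
proof -
  have eq: "simplicial_suspension K = (\<lambda>(\<sigma>, \<tau>). \<sigma> <+> \<tau>) ` (K \<times> boundary_1_simplex)"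
    by (auto simp: simplicial_suspension_def complex_join_def)
  have "\<rho> \<in> simplicial_suspension K" if "\<sigma> \<in> K" "\<tau> \<in> boundary_1_simplex" "\<rho> \<subseteq> \<sigma> <+> \<tau>" for \<sigma> \<tau> \<rho>
  proof -
    \<comment> \<open>A subset of a simplex of the join is the join of its traces on the two sides,
      and each trace is again a simplex.\<close>
    have "\<rho> = (Inl -` \<rho>) <+> (Inr -` \<rho>)"
    proof (rule set_eqI)
      show "z \<in> \<rho> \<longleftrightarrow> z \<in> (Inl -` \<rho>) <+> (Inr -` \<rho>)" for z
        by (cases z) (auto simp: Plus_def)
    qed
    moreover have "Inl -` \<rho> \<subseteq> \<sigma>" "Inr -` \<rho> \<subseteq> \<tau>" using that(3) by auto
    then have "Inl -` \<rho> \<in> K" "Inr -` \<rho> \<in> boundary_1_simplex"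
      using that(1,2) assms by (auto simp: finite_abstract_complex_def boundary_1_simplex_def)
    ultimately show ?thesis by (auto simp: simplicial_suspension_def complex_join_def)
  qed
  then have down: "\<rho> \<in> simplicial_suspension K"
    if "\<rho>' \<in> simplicial_suspension K" "\<rho> \<subseteq> \<rho>'" for \<rho> \<rho>'
    using that unfolding simplicial_suspension_def complex_join_def by blast
  have ne: "{} <+> {} \<in> simplicial_suspension K"
    using assms unfolding simplicial_suspension_def complex_join_def finite_abstract_complex_def
      boundary_1_simplex_eq by blast
  show ?thesis
    unfolding finite_abstract_complex_def
  proof (intro conjI ballI allI impI)
    show "finite (simplicial_suspension K)"
      using assms by (simp add: eq finite_abstract_complex_def boundary_1_simplex_eq)
    show "finite \<rho>" if "\<rho> \<in> simplicial_suspension K" for \<rho>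
      using that assms by (auto simp: eq finite_abstract_complex_def boundary_1_simplex_eq)
    show "{} \<in> simplicial_suspension K" using ne by (simp add: Plus_def)
    show "\<rho> \<in> simplicial_suspension K"
      if "\<rho>' \<in> simplicial_suspension K" "\<rho> \<subseteq> \<rho>'" for \<rho> \<rho>'
      using down that .
  qed
qed

text \<open>The poles are chosen inside the given vertex type, whereas
  \<open>simplicial_suspension\<close> enlarges the type at each iteration. This lets three
  suspensions be found within a single independence complex.\<close>

definition suspension_at :: "'a \<Rightarrow> 'a \<Rightarrow> 'a set set \<Rightarrow> 'a set set" where
  "suspension_at a b K = {\<sigma> \<union> \<tau> |\<sigma> \<tau>. \<sigma> \<in> K \<and> \<tau> \<in> {{}, {a}, {b}}}"

text \<open>The vertex map extends that of the base by sending \<open>True\<close> to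
  \<open>a\<close> and \<open>False\<close> to \<open>b\<close>; it stays injective because the
  poles are distinct and new.\<close>

lemma isomorphic_suspension_at:
  assumes "simplicially_isomorphic K L" "a \<noteq> b" "a \<notin> \<Union>L" "b \<notin> \<Union>L"
  shows "simplicially_isomorphic (simplicial_suspension K) (suspension_at a b L)"
proof -
  obtain f where f: "inj_on f (\<Union>K)" "L = (`) f ` K"
    using assms(1) by (auto simp: simplicially_isomorphic_def)
  let ?g = "case_sum f (\<lambda>t. if t then a else b)"
  have img: "?g ` (\<sigma> <+> \<tau>) = f ` \<sigma> \<union> (\<lambda>t. if t then a else b) ` \<tau>" for \<sigma> \<tau>
    by (force simp: Plus_def image_Un image_image)
  have "inj_on ?g (\<Union>(simplicial_suspension K))"
  proof (rule inj_onI)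
    fix x y assume "x \<in> \<Union>(simplicial_suspension K)" "y \<in> \<Union>(simplicial_suspension K)" "?g x = ?g y"
    moreover have K: "z \<in> \<Union>K" if "Inl z \<in> \<Union>(simplicial_suspension K)" for z
      using that by (auto simp: simplicial_suspension_def complex_join_def)
    moreover have "f z \<noteq> a" "f z \<noteq> b" if "Inl z \<in> \<Union>(simplicial_suspension K)" for z
      using K[OF that] assms(3,4) f(2) by auto
    ultimately show "x = y"
      using assms(2) inj_onD[OF f(1)]
      by (cases x; cases y) (simp_all split: if_splits del: Union_iff, metis+)
  qed
  moreover have "suspension_at a b L = (`) ?g ` simplicial_suspension K"
  proof -
    have ab: "{{}, {a}, {b}} = (`) (\<lambda>t. if t then a else b) ` boundary_1_simplex"
      by (simp add: boundary_1_simplex_eq)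
    have "(`) ?g ` simplicial_suspension K = {?g ` (\<sigma> <+> \<tau>) |\<sigma> \<tau>. \<sigma> \<in> K \<and> \<tau> \<in> boundary_1_simplex}"
      by (auto simp: simplicial_suspension_def complex_join_def)
    also have "\<dots> = suspension_at a b L"
      unfolding img suspension_at_def ab f(2) by blast
    finally show ?thesis ..
  qed
  ultimately show ?thesis unfolding simplicially_isomorphic_def by blast
qed

text \<open>Disjoint union of graphs becomes join of independence complexes, and a single edge has
  two points as its complex: an independent set contains at most one end and is otherwise free on
  \<open>V\<close>.\<close>

lemma indep_disjoint_edge:
  assumes "symp E" "E a b" "\<not> E a a" "\<not> E b b" "\<And>x. x \<in> V \<Longrightarrow> \<not> E a x \<and> \<not> E b x"
  shows "indep (insert a (insert b V)) E = suspension_at a b (indep V E)"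
proof (intro set_eqI iffI)
  fix \<sigma> assume \<sigma>: "\<sigma> \<in> indep (insert a (insert b V)) E"
  then have "\<not> (a \<in> \<sigma> \<and> b \<in> \<sigma>)" using assms(2) by (auto simp: indep_def)
  moreover have "\<sigma> - {a, b} \<in> indep V E" using \<sigma> by (auto simp: indep_def)
  moreover have "\<sigma> = (\<sigma> - {a, b}) \<union> (\<sigma> \<inter> {a, b})" by auto
  moreover have "\<sigma> \<inter> {a, b} \<in> {{}, {a}, {b}}" using calculation(1) by auto
  ultimately show "\<sigma> \<in> suspension_at a b (indep V E)" unfolding suspension_at_def by blast
next
  fix \<sigma> assume "\<sigma> \<in> suspension_at a b (indep V E)"
  then obtain \<rho> \<tau> where "\<sigma> = \<rho> \<union> \<tau>" "\<rho> \<in> indep V E" "\<tau> \<in> {{}, {a}, {b}}"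
    by (auto simp: suspension_at_def)
  moreover have "\<not> E x a \<and> \<not> E x b" if "x \<in> V" for x
    using assms(1) assms(5)[OF that] by (auto dest: sympD)
  ultimately show "\<sigma> \<in> indep (insert a (insert b V)) E"
    using assms(3-5) by (auto simp: indep_def)
qed

lemma isomorphic_image:
  assumes "simplicially_isomorphic K L" "inj_on f (\<Union>L)"
  shows "simplicially_isomorphic K ((`) f ` L)"
proof -
  obtain g where g: "inj_on g (\<Union>K)" "L = (`) g ` K"
    using assms(1) by (auto simp: simplicially_isomorphic_def)
  have "\<Union>L = g ` \<Union>K" using g(2) by auto
  then have "inj_on (f \<circ> g) (\<Union>K)" using assms(2) g(1) by (simp add: comp_inj_on)
  moreover have "(`) f ` L = (`) (f \<circ> g) ` K" unfolding g(2) by (simp add: image_image o_def)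
  ultimately show ?thesis unfolding simplicially_isomorphic_def by blast
qed

section \<open>The grid replacement\<close>

definition end_points :: "point list" where
  "end_points = [(1,3),(1,4),(1,5),(2,5),(3,3),(3,4)]"

text \<open>Since \<open>place\<close> sends \<open>(i, 6)\<close> to \<open>v (4 - i)\<close>, the
  first three entries are the edges from \<open>u 1\<close>, \<open>u 2\<close>, \<open>u 3\<close>
  to \<open>v 1\<close>, \<open>v 2\<close>, \<open>v 3\<close>. Three entries join the six
  remaining interior points in pairs, and the other four are the columns 1 and 6.\<close>

definition end_edges :: "(point \<times> point) list" where
  "end_edges =
    [((1,1),(3,6)), ((2,1),(2,6)), ((3,1),(1,6)), ((1,3),(1,4)), ((3,3),(3,4)),
     ((1,1),(2,1)), ((1,5),(2,5)), ((1,6),(2,6)), ((2,1),(3,1)), ((2,6),(3,6))]"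

text \<open>The certificates mention only the grid, so one evaluation serves every \<open>G\<close>.
  In the first fold, for instance, the neighbours \<open>(2, 1)\<close> and \<open>(3, 2)\<close> of
  \<open>(2, 2)\<close> are adjacent to \<open>(3, 1)\<close>, and \<open>(1, 2)\<close> and
  \<open>(2, 3)\<close> to \<open>(1, 3)\<close>; hence \<open>(1, 3)\<close> may be
  discarded.\<close>

lemma moves_grid: "moves grid_moves grid_points grid_edges (end_points, end_edges)"
  by code_simp

lemma Upair_commute: "Upair x y = Upair y x"
  by simp

lemma glue_adj_iff_Upair:
  "glue_adj B u v F x y \<longleftrightarrow> (\<exists>p q. x = Inl p \<and> y = Inl q \<and> B p q) \<or>
     Upair x y \<in> (\<lambda>(p, q). Upair (place u v p) (place u v q)) ` set F"
proof -
  have "Upair x y \<in> (\<lambda>(p, q). Upair (place u v p) (place u v q)) ` set F \<longleftrightarrow>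
    (\<exists>p q. (p, q) \<in> set F \<and> Upair x y = Upair (place u v p) (place u v q))"
    by (auto simp: image_iff Bex_def simp del: Upair_inject)
  then show ?thesis unfolding glue_adj_def adj_def Upair_inject by blast
qed

lemma Upair_in_map_Inl:
  "Upair x y \<in> map_uprod Inl ` M \<longleftrightarrow> (\<exists>p q. x = Inl p \<and> y = Inl q \<and> Upair p q \<in> M)"
proof
  assume "Upair x y \<in> map_uprod Inl ` M"
  then obtain e where e: "e \<in> M" "Upair x y = map_uprod Inl e" by auto
  obtain p q where "e = Upair p q" by (cases e) auto
  then show "\<exists>p q. x = Inl p \<and> y = Inl q \<and> Upair p q \<in> M"
    using e by (auto simp: Upair_inject insert_commute Upair_commute)
qed (force simp: image_iff)

text \<open>The list \<open>grid_edges\<close> repeats the edges of columns 1 and 6, which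
  \<open>G\<close> already supplies, because the fold checks see adjacencies only through the list.
  As these edges survive the removal of \<open>R\<close>, the repetition leaves the edge set
  unchanged.\<close>

lemma independence_complex_replace_grid:
  fixes G :: "'v multigraph" and u v :: "nat \<Rightarrow> 'v"
  defines "R \<equiv> {#Upair (u 1) (v 1), Upair (u 2) (v 2), Upair (u 3) (v 3)#}"
  defines "B \<equiv> \<lambda>p q. Upair p q \<in># graph_edges G - R"
  assumes "{Upair (u 1) (u 2), Upair (u 2) (u 3), Upair (v 1) (v 2), Upair (v 2) (v 3)}
    \<subseteq> set_mset (graph_edges G - R)"
  shows "independence_complex (replace_grid G u v) =
    glue_complex (graph_verts G) B u v grid_points grid_edges"
proof -
  let ?H = "replace_grid G u v"
  have "graph_verts ?H = glue_verts (graph_verts G) grid_points"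
  proof -
    have "{1..3::nat} = {1, 2, 3}" "{2..5::nat} = {2, 3, 4, 5}" by auto
    then show ?thesis by (auto simp: replace_grid_def glue_verts_def grid_points_def)
  qed
  moreover have "Upair x y \<in># graph_edges ?H \<longleftrightarrow> glue_adj B u v grid_edges x y" for x y
  proof -
    have sets: "{1..3::nat} = {1, 2, 3}" "{2..5::nat} = {2, 3, 4, 5}" by auto
    \<comment> \<open>Apart from the four column edges taken out here, the list consists of exactly
      the edges that the replacement adds.\<close>
    have H: "set_mset (graph_edges ?H) = map_uprod Inl ` set_mset (graph_edges G - R) \<union>
      (\<lambda>(p, q). Upair (place u v p) (place u v q)) ` (set grid_edges -
        {((1,1),(2,1)), ((2,1),(3,1)), ((1,6),(2,6)), ((2,6),(3,6))})"
      unfolding replace_grid_def Let_def sets grid_edges_def R_def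
      by (simp add: place_def insert_Diff_if) blast
    have "(\<lambda>(p, q). Upair (place u v p) (place u v q)) `
        {((1,1),(2,1)), ((2,1),(3,1)), ((1,6),(2,6)), ((2,6),(3,6))}
      \<subseteq> map_uprod Inl ` set_mset (graph_edges G - R)"
    proof -
      have "map_uprod Inl ` {Upair (u 1) (u 2), Upair (u 2) (u 3), Upair (v 1) (v 2), Upair (v 2) (v 3)}
        \<subseteq> map_uprod Inl ` set_mset (graph_edges G - R)"
        using assms(3) by (rule image_mono)
      then show ?thesis by (auto simp: place_def Upair_commute)
    qed
    then have "set_mset (graph_edges ?H) = map_uprod Inl ` set_mset (graph_edges G - R) \<union>
      (\<lambda>(p, q). Upair (place u v p) (place u v q)) ` set grid_edges"
      unfolding H by blast
    then show ?thesis unfolding glue_adj_iff_Upair by (simp add: Upair_in_map_Inl B_def)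
  qed
  ultimately show ?thesis
    by (simp add: independence_complex_def independent_set_def indep_def)
qed

lemma glue_complex_end_points:
  fixes G :: "'v multigraph" and u v :: "nat \<Rightarrow> 'v"
  defines "R \<equiv> {#Upair (u 1) (v 1), Upair (u 2) (v 2), Upair (u 3) (v 3)#}"
  defines "B \<equiv> \<lambda>p q. Upair p q \<in># graph_edges G - R"
  assumes col: "{Upair (u 1) (u 2), Upair (u 2) (u 3), Upair (v 1) (v 2), Upair (v 2) (v 3)}
    \<subseteq> set_mset (graph_edges G - R)"
    and "R \<subseteq># graph_edges G"
  shows "glue_complex (graph_verts G) B u v end_points end_edges =
    suspension_at (Inr (1,3)) (Inr (1,4)) (suspension_at (Inr (1,5)) (Inr (2,5))
      (suspension_at (Inr (3,3)) (Inr (3,4)) ((`) Inl ` independence_complex G)))"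
proof -
  let ?E = "glue_adj B u v end_edges"
  have sym: "symp ?E"
    by (rule symp_glue_adj) (simp add: B_def symp_def Upair_commute)
  have nbr: "?E (Inr (1,3)) y \<longleftrightarrow> y = Inr (1,4)" "?E (Inr (1,4)) y \<longleftrightarrow> y = Inr (1,3)"
    "?E (Inr (1,5)) y \<longleftrightarrow> y = Inr (2,5)" "?E (Inr (2,5)) y \<longleftrightarrow> y = Inr (1,5)"
    "?E (Inr (3,3)) y \<longleftrightarrow> y = Inr (3,4)" "?E (Inr (3,4)) y \<longleftrightarrow> y = Inr (3,3)" for y
    by (auto simp: glue_adj_interior interior_point_def adj_def end_edges_def place_def)
  have E: "?E (Inl p) (Inl q) \<longleftrightarrow> Upair p q \<in># graph_edges G" for p q
  proof -
    \<comment> \<open>Between vertices of \<open>G\<close>, the list \<open>end_edges\<close>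
      contributes the edges of \<open>R\<close> and four column edges, which \<open>col\<close>
      already places in \<open>graph_edges G - R\<close>.\<close>
    have "?E (Inl p) (Inl q) \<longleftrightarrow> Upair p q \<in># graph_edges G - R \<or> Upair p q \<in># R"
    proof -
      have Inl: "Upair (Inl p) (Inl q) = Upair (Inl r) (Inl s) \<longleftrightarrow> Upair p q = Upair r s"
        "Upair (Inl p) (Inl q) \<noteq> Upair (Inr a) (Inr b)" for r s :: 'v and a b :: point
        by (auto simp: Upair_inject)
      show ?thesis
        unfolding glue_adj_iff_Upair end_edges_def B_def
        using col by (auto simp: place_def Inl R_def Upair_commute[of "v 3" "v 2"]
            Upair_commute[of "v 2" "v (Suc 0)"] simp del: Upair_inject)
    qed
    also have "\<dots> \<longleftrightarrow> Upair p q \<in># (graph_edges G - R) + R" by simp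
    \<comment> \<open>Because \<open>R\<close> is a submultiset of the edges, putting it back
      restores \<open>G\<close> exactly.\<close>
    also have "(graph_edges G - R) + R = graph_edges G"
      using \<open>R \<subseteq># graph_edges G\<close> by (rule subset_mset.diff_add)
    finally show ?thesis .
  qed
  have "indep (Inl ` graph_verts G) ?E = (`) Inl ` independence_complex G"
  proof (intro set_eqI iffI)
    fix \<sigma> assume \<sigma>: "\<sigma> \<in> indep (Inl ` graph_verts G) ?E"
    then obtain \<rho> where "\<rho> \<subseteq> graph_verts G" "\<sigma> = Inl ` \<rho>"
      unfolding indep_def by (auto elim: subset_imageE)
    then show "\<sigma> \<in> (`) Inl ` independence_complex G"
      using \<sigma> by (auto simp: indep_def E independence_complex_def independent_set_def)
  qed (auto simp: indep_def E independence_complex_def independent_set_def)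
  moreover have "indep (insert (Inr (3,3)) (insert (Inr (3,4)) (Inl ` graph_verts G))) ?E =
    suspension_at (Inr (3,3)) (Inr (3,4)) (indep (Inl ` graph_verts G) ?E)"
    by (rule indep_disjoint_edge[OF sym]) (auto simp: nbr[unfolded One_nat_def])
  moreover have "indep (insert (Inr (1,5)) (insert (Inr (2,5)) W)) ?E =
    suspension_at (Inr (1,5)) (Inr (2,5)) (indep W ?E)"
    if "W = insert (Inr (3,3)) (insert (Inr (3,4)) (Inl ` graph_verts G))" for W
    by (rule indep_disjoint_edge[OF sym]) (auto simp: nbr[unfolded One_nat_def] that)
  moreover have "indep (insert (Inr (1,3)) (insert (Inr (1,4)) W)) ?E =
    suspension_at (Inr (1,3)) (Inr (1,4)) (indep W ?E)"
    if "W = insert (Inr (1,5)) (insert (Inr (2,5))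
      (insert (Inr (3,3)) (insert (Inr (3,4)) (Inl ` graph_verts G))))" for W
    by (rule indep_disjoint_edge[OF sym]) (auto simp: nbr[unfolded One_nat_def] that)
  moreover have "glue_verts (graph_verts G) end_points =
    insert (Inr (1,3)) (insert (Inr (1,4)) (insert (Inr (1,5)) (insert (Inr (2,5))
      (insert (Inr (3,3)) (insert (Inr (3,4)) (Inl ` graph_verts G))))))"
    by (auto simp: glue_verts_def end_points_def)
  ultimately show ?thesis by metis
qed

section \<open>The simple homotopy equivalence from the grid moves and the three suspensions\<close>

theorem theorem1p3:
  fixes G :: "'v multigraph" and u v :: "nat \<Rightarrow> 'v"
  assumes "finite_graph G"
    and "{u 1, u 2, u 3, v 1, v 2, v 3} \<subseteq> graph_verts G"
    and "distinct [u 1, u 2, u 3, v 1, v 2, v 3]"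
    and "graph_edges (full_subgraph G {u 1, u 2, u 3, v 1, v 2, v 3}) =
           {#Upair (u 1) (u 2), Upair (u 2) (u 3), Upair (v 1) (v 2), Upair (v 2) (v 3),
             Upair (u 1) (v 1), Upair (u 2) (v 2), Upair (u 3) (v 3)#}"
  shows "same_simple_homotopy_type
           (independence_complex (replace_grid G u v))
           (simplicial_suspension (simplicial_suspension (simplicial_suspension
             (independence_complex G))))"
proof -
  let ?C = "{#Upair (u 1) (u 2), Upair (u 2) (u 3), Upair (v 1) (v 2), Upair (v 2) (v 3)#}"
  define R where "R = {#Upair (u 1) (v 1), Upair (u 2) (v 2), Upair (u 3) (v 3)#}"
  define B where "B = (\<lambda>p q. Upair p q \<in># graph_edges G - R)"
  let ?V = "graph_verts G" and ?I = "independence_complex G"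
  let ?S = "simplicial_suspension (simplicial_suspension (simplicial_suspension ?I))"
  let ?K = "glue_complex ?V B u v grid_points grid_edges"
  let ?L = "glue_complex ?V B u v end_points end_edges"
  have "?C + R = graph_edges (full_subgraph G {u 1, u 2, u 3, v 1, v 2, v 3})"
    unfolding assms(4) R_def by simp
  also have "\<dots> \<subseteq># graph_edges G" by (simp add: full_subgraph_def)
  finally have CR: "?C + R \<subseteq># graph_edges G" .
  then have R: "R \<subseteq># graph_edges G" using mset_subset_eq_add_right subset_mset.order_trans by blast
  \<comment> \<open>Containing the sum \<open>?C + R\<close> with multiplicities guarantees that all
    column edges are left after \<open>R\<close> is subtracted.\<close>
  have "?C \<subseteq># graph_edges G - R" using CR by (simp only: subset_mset.le_diff_conv2[OF R])
  then have C: "{Upair (u 1) (u 2), Upair (u 2) (u 3), Upair (v 1) (v 2), Upair (v 2) (v 3)}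
    \<subseteq> set_mset (graph_edges G - R)"
    using set_mset_mono by fastforce
  have finV: "finite ?V" using assms(1) by (simp add: finite_graph_def)
  have symB: "symp B" by (simp add: B_def symp_def Upair_commute)
  have H: "independence_complex (replace_grid G u v) = ?K"
    using independence_complex_replace_grid[of u v G] C unfolding R_def B_def by blast
  have L: "?L = suspension_at (Inr (1,3)) (Inr (1,4)) (suspension_at (Inr (1,5)) (Inr (2,5))
      (suspension_at (Inr (3,3)) (Inr (3,4)) ((`) Inl ` ?I)))"
    using glue_complex_end_points[of u v G] C R unfolding R_def B_def by blast
  have "finite (glue_verts ?V grid_points)" using finV by (simp add: glue_verts_def)
  then obtain f :: "'v + point \<Rightarrow> nat" where f: "inj_on f (glue_verts ?V grid_points)"
    using finite_imp_inj_to_nat_seg by metis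
  have "inj_on f (\<Union>?K)" using f Union_indep by (rule inj_on_subset)
  then have KK: "simplicially_isomorphic ?K ((`) f ` ?K)"
    unfolding simplicially_isomorphic_def by blast
  have "simplicially_isomorphic ?I ((`) Inl ` ?I)"
    unfolding simplicially_isomorphic_def by (intro exI[of _ Inl]) simp
  \<comment> \<open>The rule applies three times, outermost poles first; every pair of poles is
    distinct and new to the complex below it.\<close>
  then have "simplicially_isomorphic ?S ?L"
    unfolding L by (intro isomorphic_suspension_at) (auto simp: suspension_at_def)
  \<comment> \<open>The final vertices are among the initial ones, so the numbering \<open>f\<close>
    stays injective on them.\<close>
  moreover have "inj_on f (\<Union>?L)"
  proof (rule inj_on_subset[OF f])
    have "glue_verts ?V end_points \<subseteq> glue_verts ?V grid_points"
      by (auto simp: glue_verts_def end_points_def grid_points_def)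
    then show "\<Union>?L \<subseteq> glue_verts ?V grid_points" by (rule order_trans[OF Union_indep])
  qed
  ultimately have "simplicially_isomorphic ?S ((`) f ` ?L)" by (rule isomorphic_image)
  moreover have "simple_homotopy_step\<^sup>*\<^sup>* ((`) f ` ?K) ((`) f ` ?L)"
    by (rule moves_sound[OF finV symB moves_grid f])
  moreover have "finite_abstract_complex ?K"
    using finV by (simp add: finite_complex_indep glue_verts_def)
  moreover have "?I = indep ?V (\<lambda>x y. Upair x y \<in># graph_edges G)"
    by (simp add: independence_complex_def independent_set_def indep_def)
  then have "finite_abstract_complex ?S"
    using finV by (simp add: finite_complex_suspension finite_complex_indep)
  ultimately show ?thesis
    unfolding same_simple_homotopy_type_def H using KK
    by (intro conjI exI[of _ "(`) f ` ?K"] exI[of _ "(`) f ` ?L"])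
qed

end
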